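(* Let $d\in\mathbb{N}$, let $(A,\alpha,\mathbb{Z}_+^d)$ be a C*-dynamical system and let $\mathcal{K}=\{\mathcal{K}_F\}_{F\subseteq[d]}$ and $\mathcal{L}=\{\mathcal{L}_F\}_{F\subseteq[d]}$ be $2^d$-tuples of the associated product system $X_\alpha$. Then $\mathcal{L}$ is a $\mathcal{K}$-relative O-family of $X_\alpha$ if and only if the following three conditions hold: (i) $\mathcal{L}$ consists of ideals of $A$, (ii) $\mathcal{L}_F=\alpha_{\underline{i}}^{-1}(\mathcal{L}_F)\cap\mathcal{L}_{F\cup\{i\}}$ for all $F\subsetneq[d]$ and $i\in[d]\setminus F$, and (iii) $\mathcal{K}_F\subseteq\mathcal{L}_F$ for all $F\subseteq[d]$.
   Context: Ideals of C*-algebras are two-sided and norm-closed; $[S]$ is the norm-closed linear span of $S$. $\mathbb{Z}_+=\{0,1,\dots\}$, $[d]=\{1,\dots,d\}$, and $\underline{i}$ ($i\in[d]$) are the standard generators of $\mathbb{Z}_+^d$. A C*-correspondence over $A$ is a right Hilbert $A$-module $X$ together with a $*$-homomorphism $\phi_X:A\to\mathcal{L}(X)$ into the adjointable operators (the left action; $a\xi:=\phi_X(a)\xi$). A C*-dynamical system $(A,\alpha,\mathbb{Z}_+^d)$ consists of a C*-algebra $A$ and a unital semigroup homomorphism $\alpha:\mathbb{Z}_+^d\to\mathrm{End}(A)$ into the $*$-endomorphisms of $A$. The associated product system $X_\alpha=\{X_{\alpha,\underline{n}}\}_{\underline{n}\in\mathbb{Z}_+^d}$ has fibres $X_{\alpha,\underline{n}}=[\alpha_{\underline{n}}(A)A]$,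 with right Hilbert $A$-module structure inherited from $A$ (right multiplication, $\langle\xi,\eta\rangle=\xi^*\eta$), left action $\phi_{\underline{n}}(a)\xi=\alpha_{\underline{n}}(a)\xi$, and multiplication maps $X_{\alpha,\underline{n}}\otimes_AX_{\alpha,\underline{m}}\to X_{\alpha,\underline{n}+\underline{m}}$, $\xi_{\underline{n}}\otimes\xi_{\underline{m}}\mapsto\alpha_{\underline{m}}(\xi_{\underline{n}})\xi_{\underline{m}}$. It is a proper product system over $\mathbb{Z}_+^d$ with coefficients in $A$ (all left actions are by compact operators). For a product system $X=\{X_{\underline{n}}\}$ over $\mathbb{Z}_+^d$ with coefficients in $A$ and an ideal $I\subseteq A$, $X_{\underline{n}}^{-1}(I)=\{a\in A:\langle\xi,a\eta\rangle\in I\text{ for all }\xi,\eta\in X_{\underline{n}}\}$. A $2^d$-tuple of $X$ is a family $\{\mathcal{L}_F\}_{F\subseteq[d]}$ of non-empty subsets of $A$. A T-family of a proper $X$ is a $2^d$-tuple $\mathcal{L}$ consisting of ideals of $A$ with $\mathcal{L}_F=X_{\underline{i}}^{-1}(\mathcal{L}_F)\cap\mathcal{L}_{F\cup\{i\}}$ for all $F\subsetneq[d]$, $i\in[d]\setminus F$. Given a $2^d$-tuple $\mathcal{K}$ of $X$, a $\mathcal{K}$-relative O-family of $X$ is a T-family $\mathcal{L}$ of $X$ such that $\mathcal{K}_F\subseteq\mathcal{L}_F$ for all $F\subseteq[d]$. *)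

theory Defs
  imports "HOL-Analysis.Analysis" "HOL-Library.Poly_Mapping"
begin

section \<open>C*-algebras\<close>

class complex_vector = real_vector +
  fixes scaleC :: "complex \<Rightarrow> 'a \<Rightarrow> 'a"  (infixr \<open>*\<^sub>C\<close> 75)
  assumes scaleC_add_right: "c *\<^sub>C (x + y) = c *\<^sub>C x + c *\<^sub>C y"
    and scaleC_add_left: "(b + c) *\<^sub>C x = b *\<^sub>C x + c *\<^sub>C x"
    and scaleC_scaleC: "b *\<^sub>C c *\<^sub>C x = (b * c) *\<^sub>C x"
    and scaleC_of_real: "complex_of_real r *\<^sub>C x = r *\<^sub>R x"

global_interpretation complex_vector:
  vector_space "scaleC :: complex \<Rightarrow> 'a \<Rightarrow> 'a :: complex_vector"
  defines csubspace = complex_vector.subspace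
    and cspan = complex_vector.span
proof
  show "1 *\<^sub>C x = x" for x :: 'a
    using scaleC_of_real[of 1 x] by simp
qed (simp_all add: scaleC_add_right scaleC_add_left scaleC_scaleC)

text \<open>Submultiplicativity of the norm comes from \<^class>\<open>real_normed_algebra\<close> and completeness
  from \<^class>\<open>banach\<close>; no unit is required, and the zero algebra is allowed.\<close>

class cstar_algebra = complex_vector + real_normed_algebra + banach +
  fixes star :: "'a \<Rightarrow> 'a"
  assumes mult_scaleC_left: "(c *\<^sub>C x) * y = c *\<^sub>C (x * y)"
    and mult_scaleC_right: "x * (c *\<^sub>C y) = c *\<^sub>C (x * y)"
    and norm_scaleC: "norm (c *\<^sub>C x) = cmod c * norm x"
    and star_star: "star (star x) = x"
    and star_add: "star (x + y) = star x + star y"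
    and star_scaleC: "star (c *\<^sub>C x) = cnj c *\<^sub>C star x"
    and star_mult: "star (x * y) = star y * star x"
    and cstar_identity: "norm (star x * x) = (norm x)\<^sup>2"

definition closed_cspan :: "'a::cstar_algebra set \<Rightarrow> 'a set"
  where "closed_cspan S = closure (cspan S)"

definition cstar_ideal :: "'a::cstar_algebra set \<Rightarrow> bool"
  where "cstar_ideal I \<longleftrightarrow>
    csubspace I \<and> closed I \<and> (\<forall>a. \<forall>x\<in>I. a * x \<in> I \<and> x * a \<in> I)"

definition star_endomorphism :: "('a::cstar_algebra \<Rightarrow> 'a) \<Rightarrow> bool"
  where "star_endomorphism f \<longleftrightarrow>
    (\<forall>x y. f (x + y) = f x + f y) \<and> (\<forall>c x. f (c *\<^sub>C x) = c *\<^sub>C f x) \<and>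
    (\<forall>x y. f (x * y) = f x * f y) \<and> (\<forall>x. f (star x) = star (f x))"


section \<open>Dynamical systems and product systems\<close>

text \<open>Multi-indices are finitely supported functions; \<open>multi_indices d\<close> is the monoid of
  $d$-tuples of non-negative integers, with coordinates numbered from 1 to \<open>d\<close>.\<close>

type_synonym multi_index = "nat \<Rightarrow>\<^sub>0 nat"

definition multi_indices :: "nat \<Rightarrow> multi_index set"
  where "multi_indices d = {n. Poly_Mapping.keys n \<subseteq> {1..d}}"

definition gen :: "nat \<Rightarrow> multi_index"
  where "gen i = Poly_Mapping.single i 1"

definition cstar_dynamical_system ::
    "nat \<Rightarrow> (multi_index \<Rightarrow> 'a::cstar_algebra \<Rightarrow> 'a) \<Rightarrow> bool"
  where "cstar_dynamical_system d \<alpha> \<longleftrightarrow>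
    (\<forall>n\<in>multi_indices d. star_endomorphism (\<alpha> n)) \<and> \<alpha> 0 = id \<and>
    (\<forall>n\<in>multi_indices d. \<forall>m\<in>multi_indices d. \<alpha> (n + m) = \<alpha> n \<circ> \<alpha> m)"

text \<open>The structure carried by a product system over the C*-algebra \<open>'a\<close>: every fibre is a
  subspace of \<open>'x\<close> with its own right action, \<open>'a\<close>-valued inner product and left action, and
  \<open>ps_mult X n m\<close> is the multiplication map on elementary tensors. The laws of a product system are
  not part of the record; none of the notions below depends on them.\<close>

record ('x::complex_vector, 'a::cstar_algebra) product_system =
  fibre :: "multi_index \<Rightarrow> 'x set"
  right_act :: "multi_index \<Rightarrow> 'x \<Rightarrow> 'a \<Rightarrow> 'x"
  inner_prod :: "multi_index \<Rightarrow> 'x \<Rightarrow> 'x \<Rightarrow> 'a"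
  left_act :: "multi_index \<Rightarrow> 'a \<Rightarrow> 'x \<Rightarrow> 'x"
  ps_mult :: "multi_index \<Rightarrow> multi_index \<Rightarrow> 'x \<Rightarrow> 'x \<Rightarrow> 'x"

definition dyn_product_system ::
    "(multi_index \<Rightarrow> 'a::cstar_algebra \<Rightarrow> 'a) \<Rightarrow> ('a, 'a) product_system"
  where "dyn_product_system \<alpha> =
    \<lparr>fibre = (\<lambda>n. closed_cspan {\<alpha> n a * b | a b. True}),
     right_act = (\<lambda>n \<xi> a. \<xi> * a),
     inner_prod = (\<lambda>n \<xi> \<eta>. star \<xi> * \<eta>),
     left_act = (\<lambda>n a \<xi>. \<alpha> n a * \<xi>),
     ps_mult = (\<lambda>n m \<xi> \<eta>. \<alpha> m \<xi> * \<eta>)\<rparr>"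

definition ps_preimage ::
    "('x::complex_vector, 'a::cstar_algebra) product_system \<Rightarrow> multi_index \<Rightarrow> 'a set \<Rightarrow> 'a set"
  where "ps_preimage X n I =
    {a. \<forall>\<xi>\<in>fibre X n. \<forall>\<eta>\<in>fibre X n. inner_prod X n \<xi> (left_act X n a \<eta>) \<in> I}"


section \<open>Relative O-families\<close>

text \<open>Families indexed by the subsets of \<open>{1..d}\<close> are functions on all of \<open>nat set\<close>; values at
  other index sets are ignored.\<close>

definition two_power_tuple :: "nat \<Rightarrow> (nat set \<Rightarrow> 'a set) \<Rightarrow> bool"
  where "two_power_tuple d L \<longleftrightarrow> (\<forall>F. F \<subseteq> {1..d} \<longrightarrow> L F \<noteq> {})"

definition T_family ::
    "nat \<Rightarrow> ('x::complex_vector, 'a::cstar_algebra) product_system \<Rightarrow> (nat set \<Rightarrow> 'a set) \<Rightarrow> bool"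
  where "T_family d X L \<longleftrightarrow>
    two_power_tuple d L \<and> (\<forall>F. F \<subseteq> {1..d} \<longrightarrow> cstar_ideal (L F)) \<and>
    (\<forall>F. F \<subset> {1..d} \<longrightarrow> (\<forall>i\<in>{1..d} - F. L F = ps_preimage X (gen i) (L F) \<inter> L (F \<union> {i})))"

definition relative_O_family ::
    "nat \<Rightarrow> ('x::complex_vector, 'a::cstar_algebra) product_system \<Rightarrow>
     (nat set \<Rightarrow> 'a set) \<Rightarrow> (nat set \<Rightarrow> 'a set) \<Rightarrow> bool"
  where "relative_O_family d X K L \<longleftrightarrow>
    T_family d X L \<and> (\<forall>F. F \<subseteq> {1..d} \<longrightarrow> K F \<subseteq> L F)"

end

(* The point is that X_i^{-1}(I) = \<alpha>_i^{-1}(I) for every ideal I, even though \<alpha>_i may be degenerate.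
   If a lies in the left-hand side, u = \<alpha>_i(a) and h = u^* u, then suitable \<xi>, \<eta> give
   <\<xi>, a \<eta>> = h^4, which lies in I; so it suffices that x^* x \<in> I implies x \<in> I.

   That implication is shown without functional calculus or approximate units.  Let h = x^* x,
   let E z = z (1 + i h / n), and let u_n z be the mean of E^k z over k < n^2.
   As h is self-adjoint, the C*-identity gives |E z|^2 \<le> (1 + |h|^2 / n^2) |z|^2, so the E^k with
   k \<le> n^2 are bounded uniformly in n.  Telescoping gives u_n (h^2) = O(1/n), and
   |u_n z|^2 \<le> C |u_n (z^* z)|, applied with z = h and then z = x, yields u_n x \<longlonglongrightarrow> 0.
   But x - u_n x \<in> I, and I is closed. *)
theory Submission
  imports Defs
begin

section \<open>Ideals contain \<open>x\<close> along with \<open>x\<^sup>* x\<close>\<close>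

lemma norm_star [simp]: "norm (star (x::'a::cstar_algebra)) = norm x"
proof -
  have le: "norm y \<le> norm (star y)" for y :: 'a
  proof (cases "y = 0")
    case False
    have "norm y * norm y \<le> norm (star y) * norm y"
      using norm_mult_ineq[of "star y" y] by (simp add: cstar_identity power2_eq_square)
    then show ?thesis using False by simp
  qed simp
  show ?thesis using le[of x] le[of "star x"] by (simp add: star_star)
qed

lemma norm_mult_star: "norm (x * star x) = (norm (x::'a::cstar_algebra))\<^sup>2"
  using cstar_identity[of "star x"] by (simp add: star_star)

lemma cstar_ideal_sum:
  "cstar_ideal I \<Longrightarrow> (\<And>k. k \<in> S \<Longrightarrow> f k \<in> I) \<Longrightarrow> sum f S \<in> I"
  unfolding cstar_ideal_def by (auto intro: complex_vector.subspace_sum)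

text \<open>Right multiplication by 1 + c h, spelled out because the algebra need not have a
  unit.\<close>

definition rmult_shift :: "complex \<Rightarrow> 'a::cstar_algebra \<Rightarrow> 'a \<Rightarrow> 'a"
  where "rmult_shift c h z = z + c *\<^sub>C (z * h)"

lemma rmult_shift_funpow_mult_left:
  "y * (rmult_shift c h ^^ k) z = (rmult_shift c h ^^ k) (y * z)"
proof (induction k)
  case (Suc k)
  have "y * rmult_shift c h w = rmult_shift c h (y * w)" for w
    by (simp add: rmult_shift_def distrib_left mult_scaleC_right mult.assoc)
  with Suc show ?case by simp
qed simp

lemma rmult_shift_funpow_mult_right:
  "(rmult_shift c h ^^ k) z * h = (rmult_shift c h ^^ k) (z * h)"
proof (induction k)
  case (Suc k)
  have "rmult_shift c h y * h = rmult_shift c h (y * h)" for y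
    by (simp add: rmult_shift_def distrib_right mult_scaleC_left)
  with Suc show ?case by simp
qed simp

text \<open>With c imaginary and h self-adjoint, the two cross terms in
  \<open>rmult_shift c h z * star (rmult_shift c h z)\<close> cancel. The growth per step is
  therefore of second order in c, so about 1 / |c|^2 steps stay bounded.\<close>

lemma norm_rmult_shift_le:
  fixes h z :: "'a::cstar_algebra"
  assumes "star h = h" and "Re c = 0"
  shows "(norm (rmult_shift c h z))\<^sup>2 \<le> (1 + (cmod c * norm h)\<^sup>2) * (norm z)\<^sup>2"
proof -
  have "cnj c = - c" using assms(2) by (simp add: complex_eq_iff)
  then have "rmult_shift c h z * star (rmult_shift c h z)
      = z * star z + (c * cnj c) *\<^sub>C ((z * h) * star (z * h))"
    using assms(1)
    by (simp add: rmult_shift_def star_add star_scaleC star_mult distrib_left distrib_right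
        mult_scaleC_left mult_scaleC_right scaleC_scaleC mult.assoc
        scaleC_add_right right_diff_distrib complex_vector.scale_right_diff_distrib)
  then have "(norm (rmult_shift c h z))\<^sup>2
      = norm (z * star z + (c * cnj c) *\<^sub>C ((z * h) * star (z * h)))"
    by (metis norm_mult_star)
  also have "\<dots> \<le> (norm z)\<^sup>2 + (cmod c)\<^sup>2 * (norm (z * h))\<^sup>2"
    using norm_triangle_ineq[of "z * star z" "(c * cnj c) *\<^sub>C ((z * h) * star (z * h))"]
    by (simp only: norm_scaleC norm_mult_star norm_mult complex_mod_cnj power2_eq_square)
  also have "\<dots> \<le> (norm z)\<^sup>2 + (cmod c)\<^sup>2 * (norm z * norm h)\<^sup>2"
    by (intro add_left_mono mult_left_mono power_mono norm_mult_ineq) auto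
  finally show ?thesis by (simp add: algebra_simps power_mult_distrib)
qed

lemma norm_rmult_shift_funpow_le:
  fixes h z :: "'a::cstar_algebra"
  assumes "star h = h" and "Re c = 0"
  shows "norm ((rmult_shift c h ^^ k) z) \<le> exp (real k * (cmod c * norm h)\<^sup>2) * norm z"
proof -
  let ?t = "(cmod c * norm h)\<^sup>2"
  have step: "norm (rmult_shift c h y) \<le> exp ?t * norm y" for y :: 'a
  proof (rule power2_le_imp_le)
    \<comment> \<open>The crude bound of \<open>sqrt (1 + ?t)\<close> by \<open>exp ?t\<close> makes
      the iterated estimate a plain exponential.\<close>
    have "(1::real) + ?t \<le> exp ?t" by (rule exp_ge_add_one_self)
    also have "\<dots> \<le> (exp ?t)\<^sup>2" by (rule self_le_power) simp_all
    finally have "(1 + ?t) * (norm y)\<^sup>2 \<le> (exp ?t)\<^sup>2 * (norm y)\<^sup>2"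
      by (rule mult_right_mono) simp
    with norm_rmult_shift_le[OF assms, of y]
    show "(norm (rmult_shift c h y))\<^sup>2 \<le> (exp ?t * norm y)\<^sup>2"
      by (simp add: power_mult_distrib)
  qed simp
  show ?thesis
  proof (induction k)
    case (Suc k)
    have "norm ((rmult_shift c h ^^ Suc k) z) \<le> exp ?t * (exp (real k * ?t) * norm z)"
      using order_trans[OF step[of "(rmult_shift c h ^^ k) z"] mult_left_mono[OF Suc, of "exp ?t"]]
      by simp
    then show ?case by (simp add: algebra_simps exp_add)
  qed simp
qed

definition rmult_shift_sum :: "complex \<Rightarrow> 'a::cstar_algebra \<Rightarrow> nat \<Rightarrow> 'a \<Rightarrow> 'a"
  where "rmult_shift_sum c h N z = (\<Sum>k<N. (rmult_shift c h ^^ k) z)"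

lemma rmult_shift_sum_mult_left:
  "y * rmult_shift_sum c h N z = rmult_shift_sum c h N (y * z)"
  by (simp add: rmult_shift_sum_def sum_distrib_left rmult_shift_funpow_mult_left)

text \<open>The increment from the k-th to the next iterate is c times the k-th iterate times h.
  When the iterates are bounded, sums of any length at \<open>z * h\<close> are thus of order 1 /
  |c|.\<close>

lemma rmult_shift_sum_telescope:
  "c *\<^sub>C rmult_shift_sum c h N (z * h) = (rmult_shift c h ^^ N) z - z"
proof (induction N)
  case (Suc N)
  have "c *\<^sub>C rmult_shift_sum c h (Suc N) (z * h)
      = (rmult_shift c h ^^ N) z - z + c *\<^sub>C ((rmult_shift c h ^^ N) z * h)"
    using Suc
    by (simp add: rmult_shift_sum_def scaleC_add_right rmult_shift_funpow_mult_right)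
  also have "\<dots> = (rmult_shift c h ^^ Suc N) z - z"
    by (simp add: rmult_shift_def)
  finally show ?case .
qed (simp add: rmult_shift_sum_def)

text \<open>In \<open>star S * S\<close>, for S the sum at z, the left factor \<open>star S\<close>
  moves inside the sum, which leaves N bounded operators applied to
  \<open>star S * z\<close>.\<close>

lemma norm_rmult_shift_sum_sq_le:
  fixes h z :: "'a::cstar_algebra"
  assumes bound: "\<And>k y :: 'a. k \<le> N \<Longrightarrow> norm ((rmult_shift c h ^^ k) y) \<le> C * norm y"
  shows "(norm (rmult_shift_sum c h N z))\<^sup>2 \<le> real N * C * norm (rmult_shift_sum c h N (star z * z))"
proof -
  let ?S = "rmult_shift_sum c h N z"
  have "(norm ?S)\<^sup>2 = norm (\<Sum>k<N. (rmult_shift c h ^^ k) (star ?S * z))"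
    by (metis cstar_identity rmult_shift_sum_mult_left rmult_shift_sum_def)
  also have "\<dots> \<le> (\<Sum>k<N. C * norm (star ?S * z))"
    by (intro order_trans[OF norm_sum] sum_mono bound) simp
  \<comment> \<open>Passing to the adjoint puts the sum on the right again, where it absorbs
    \<open>star z\<close>.\<close>
  also have "norm (star ?S * z) = norm (star z * ?S)"
    by (metis norm_star star_mult star_star)
  finally show ?thesis by (simp add: rmult_shift_sum_mult_left mult.assoc)
qed

lemma norm_rmult_shift_mean_tendsto_0:
  fixes x :: "'a::cstar_algebra"
  defines "h \<equiv> star x * x"
  shows "(\<lambda>n. norm (rmult_shift_sum (\<i> / of_nat n) h (n\<^sup>2) x) / real (n\<^sup>2)) \<longlonglongrightarrow> 0"
proof -
  define u where "u n z = norm (rmult_shift_sum (\<i> / of_nat n) h (n\<^sup>2) z) / real (n\<^sup>2)" for n z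
  \<comment> \<open>Steps of size 1 / n, taken at most n^2 times, give an exponent of at most n^2
    (|h| / n)^2 = |h|^2, independent of n.\<close>
  define C where "C = exp ((norm h)\<^sup>2)"
  have sa: "star h = h" by (simp add: h_def star_mult star_star)
  have bound: "norm ((rmult_shift (\<i> / of_nat n) h ^^ k) y) \<le> C * norm y"
    if "n > 0" "k \<le> n\<^sup>2" for n k and y :: 'a
  proof -
    have "real k \<le> (real n)\<^sup>2" using that(2) by (metis of_nat_le_iff of_nat_power)
    then have "real k * (norm h)\<^sup>2 \<le> (real n)\<^sup>2 * (norm h)\<^sup>2" by (rule mult_right_mono) simp
    then have "real k * (cmod (\<i> / of_nat n) * norm h)\<^sup>2 \<le> (norm h)\<^sup>2"
      using that(1) by (simp add: norm_divide field_simps power_divide)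
    then have "exp (real k * (cmod (\<i> / of_nat n) * norm h)\<^sup>2) * norm y \<le> C * norm y"
      unfolding C_def by (intro mult_right_mono) auto
    with norm_rmult_shift_funpow_le[OF sa, of "\<i> / of_nat n" k y] show ?thesis
      by (simp add: Re_divide_of_nat)
  qed
  have descend: "u n z \<le> sqrt (C * u n (star z * z))" if "n > 0" for n z
  proof (rule real_le_rsqrt)
    have "(u n z)\<^sup>2 \<le> real (n\<^sup>2) * C * norm (rmult_shift_sum (\<i> / of_nat n) h (n\<^sup>2) (star z * z))
        / (real (n\<^sup>2))\<^sup>2"
      unfolding u_def power_divide
      by (intro divide_right_mono norm_rmult_shift_sum_sq_le bound that) simp_all
    also have "\<dots> = C * u n (star z * z)"
      using that by (simp add: u_def power2_eq_square)
    finally show "(u n z)\<^sup>2 \<le> C * u n (star z * z)" .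
  qed
  have transfer: "(\<lambda>n. u n z) \<longlonglongrightarrow> 0" if lim: "(\<lambda>n. u n (star z * z)) \<longlonglongrightarrow> 0" for z
  proof (rule tendsto_sandwich[of "\<lambda>_. 0"])
    show "(\<lambda>n. sqrt (C * u n (star z * z))) \<longlonglongrightarrow> 0"
      using tendsto_real_sqrt[OF tendsto_mult_right_zero[OF lim]] by simp
    show "\<forall>\<^sub>F n in sequentially. u n z \<le> sqrt (C * u n (star z * z))"
      using eventually_gt_at_top[of 0] by eventually_elim (rule descend)
  qed (simp_all add: u_def)
  have "(\<lambda>n. u n (h * h)) \<longlonglongrightarrow> 0"
  proof (rule tendsto_sandwich[of "\<lambda>_. 0"])
    show "(\<lambda>n. (C + 1) * norm h / real n) \<longlonglongrightarrow> 0" by (rule lim_const_over_n)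
    have le: "u n (h * h) \<le> (C + 1) * norm h / real n" if "n > 0" for n
    proof -
      let ?S = "rmult_shift_sum (\<i> / of_nat n) h (n\<^sup>2) (h * h)"
      \<comment> \<open>One factor 1 / n of the mean is used up by the telescoping; the other
        remains as the rate of decay.\<close>
      have "norm ?S / real n = norm ((\<i> / of_nat n) *\<^sub>C ?S)"
        by (simp add: norm_scaleC norm_divide)
      also have "\<dots> \<le> norm ((rmult_shift (\<i> / of_nat n) h ^^ n\<^sup>2) h) + norm h"
        unfolding rmult_shift_sum_telescope by (rule norm_triangle_ineq4)
      also have "\<dots> \<le> (C + 1) * norm h"
        using bound[OF that order_refl, of h] by (simp add: algebra_simps)
      finally have "norm ?S / real n / real n \<le> (C + 1) * norm h / real n"
        by (rule divide_right_mono) simp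
      then show ?thesis by (simp add: u_def power2_eq_square)
    qed
    show "\<forall>\<^sub>F n in sequentially. u n (h * h) \<le> (C + 1) * norm h / real n"
      using eventually_gt_at_top[of 0] by eventually_elim (rule le)
  qed (simp_all add: u_def)
  then have "(\<lambda>n. u n h) \<longlonglongrightarrow> 0" using transfer[of h] by (simp add: sa)
  then have "(\<lambda>n. u n x) \<longlonglongrightarrow> 0" using transfer[of x] by (simp add: h_def)
  then show ?thesis by (simp add: u_def)
qed

text \<open>Modulo I the factor 1 + c h acts as the identity, since h vanishes there.\<close>

lemma rmult_shift_funpow_diff_in_ideal:
  fixes x :: "'a::cstar_algebra"
  assumes I: "cstar_ideal I" and "h \<in> I"
  shows "x - (rmult_shift c h ^^ k) x \<in> I"
proof (induction k)
  case 0
  show ?case using I by (simp add: cstar_ideal_def complex_vector.subspace_0)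
next
  case (Suc k)
  have "c *\<^sub>C ((rmult_shift c h ^^ k) x * h) \<in> I"
    using I \<open>h \<in> I\<close> by (simp add: cstar_ideal_def complex_vector.subspace_scale)
  with Suc have "(x - (rmult_shift c h ^^ k) x) - c *\<^sub>C ((rmult_shift c h ^^ k) x * h) \<in> I"
    using I by (auto simp: cstar_ideal_def intro: complex_vector.subspace_diff)
  then show ?case by (simp add: rmult_shift_def[of c h "(rmult_shift c h ^^ k) x"] diff_diff_eq)
qed

lemma cstar_ideal_star_mult_self_imp:
  fixes x :: "'a::cstar_algebra"
  assumes I: "cstar_ideal I" and xx: "star x * x \<in> I"
  shows "x \<in> I"
proof -
  define h where "h = star x * x"
  define v where "v n = (1 / real (n\<^sup>2)) *\<^sub>R rmult_shift_sum (\<i> / of_nat n) h (n\<^sup>2) x" for n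
  have "v \<longlonglongrightarrow> 0"
    using norm_rmult_shift_mean_tendsto_0[of x]
    by (subst tendsto_norm_zero_iff[symmetric]) (simp add: v_def h_def)
  then have lim: "(\<lambda>n. x - v n) \<longlonglongrightarrow> x"
    using tendsto_diff[OF tendsto_const[of x], of v 0] by simp
  \<comment> \<open>At n = 0 division by zero gives \<open>v 0 = 0\<close>, and the claim would be
    the goal itself.\<close>
  have diff: "x - v n \<in> I" if "n > 0" for n
  proof -
    have "(\<Sum>k<n\<^sup>2. x - (rmult_shift (\<i> / of_nat n) h ^^ k) x) \<in> I"
      using I xx by (intro cstar_ideal_sum rmult_shift_funpow_diff_in_ideal) (simp_all add: h_def)
    then have "complex_of_real (1 / real (n\<^sup>2)) *\<^sub>C
        (\<Sum>k<n\<^sup>2. x - (rmult_shift (\<i> / of_nat n) h ^^ k) x) \<in> I"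
      using I unfolding cstar_ideal_def by (blast intro: complex_vector.subspace_scale)
    moreover have "(\<Sum>k<n\<^sup>2. x - (rmult_shift (\<i> / of_nat n) h ^^ k) x)
        = real (n\<^sup>2) *\<^sub>R x - rmult_shift_sum (\<i> / of_nat n) h (n\<^sup>2) x"
      by (simp add: rmult_shift_sum_def sum_subtractf sum_constant_scaleR)
    ultimately show ?thesis
      using that unfolding scaleC_of_real v_def by (simp add: scaleR_diff_right)
  qed
  have "\<forall>\<^sub>F n in sequentially. x - v n \<in> I"
    using eventually_gt_at_top[of 0] by eventually_elim (rule diff)
  with lim show ?thesis
    using I Lim_in_closed_set[of I "\<lambda>n. x - v n" sequentially x] by (simp add: cstar_ideal_def)
qed

section \<open>Preimages of ideals under the fibres\<close>

lemma mult_in_fibre_dyn_product_system: "\<alpha> n a * b \<in> fibre (dyn_product_system \<alpha>) n"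
  unfolding dyn_product_system_def closed_cspan_def
  by (auto intro!: subsetD[OF closure_subset] complex_vector.span_base)

lemma ps_preimage_dyn_product_system:
  fixes I :: "'a::cstar_algebra set"
  assumes I: "cstar_ideal I" and \<alpha>: "star_endomorphism (\<alpha> n)"
  shows "ps_preimage (dyn_product_system \<alpha>) n I = \<alpha> n -` I"
proof (intro subset_antisym subsetI)
  fix a assume "a \<in> \<alpha> n -` I"
  then show "a \<in> ps_preimage (dyn_product_system \<alpha>) n I"
    using I by (simp add: ps_preimage_def dyn_product_system_def cstar_ideal_def)
next
  fix a assume a: "a \<in> ps_preimage (dyn_product_system \<alpha>) n I"
  define u where "u = \<alpha> n a"
  define h where "h = star u * u"
  have sa: "star h = h" by (simp add: h_def star_mult star_star)
  have inI: "star \<xi> * (u * \<eta>) \<in> I"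
    if "\<xi> \<in> fibre (dyn_product_system \<alpha>) n" "\<eta> \<in> fibre (dyn_product_system \<alpha>) n" for \<xi> \<eta>
    using a that by (simp add: ps_preimage_def dyn_product_system_def u_def)
  \<comment> \<open>The fibre may be smaller than the algebra, so the test vectors need a left
    factor in the range of \<open>\<alpha> n\<close>: u is the image of a, and h that of
    \<open>star a * a\<close>. This admits \<open>u * h\<close> and \<open>h * h\<close>.\<close>
  have "\<alpha> n (star a * a) = h" using \<alpha> by (simp add: star_endomorphism_def h_def u_def)
  then have "star (u * h) * (u * (h * h)) \<in> I"
    using inI[OF mult_in_fibre_dyn_product_system[of \<alpha> n a h]
        mult_in_fibre_dyn_product_system[of \<alpha> n "star a * a" h]]
    by (simp add: u_def)
  \<comment> \<open>Both sides are the fourth power of h; the right-hand form lets the previous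
    lemma descend to \<open>h * h\<close>, then h, then u.\<close>
  moreover have "star (u * h) * (u * (h * h)) = star (h * h) * (h * h)"
  proof -
    have "star (u * h) * (u * (h * h)) = h * (star u * u) * (h * h)"
      by (simp add: star_mult sa mult.assoc)
    then show ?thesis by (simp add: star_mult sa flip: h_def)
  qed
  ultimately have "star h * h \<in> I"
    using cstar_ideal_star_mult_self_imp[OF I, of "h * h"] by (simp add: sa)
  then have "h \<in> I" by (rule cstar_ideal_star_mult_self_imp[OF I])
  then have "u \<in> I" unfolding h_def by (rule cstar_ideal_star_mult_self_imp[OF I])
  then show "a \<in> \<alpha> n -` I" by (simp add: u_def)
qed

theorem corollaryC:
  fixes d :: nat
    and \<alpha> :: "multi_index \<Rightarrow> 'a::cstar_algebra \<Rightarrow> 'a"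
    and K L :: "nat set \<Rightarrow> 'a set"
  assumes "d \<ge> 1"
    and "cstar_dynamical_system d \<alpha>"
    and "two_power_tuple d K"
    and "two_power_tuple d L"
  shows "relative_O_family d (dyn_product_system \<alpha>) K L \<longleftrightarrow>
    (\<forall>F. F \<subseteq> {1..d} \<longrightarrow> cstar_ideal (L F)) \<and>
    (\<forall>F. F \<subset> {1..d} \<longrightarrow> (\<forall>i\<in>{1..d} - F. L F = \<alpha> (gen i) -` L F \<inter> L (F \<union> {i}))) \<and>
    (\<forall>F. F \<subseteq> {1..d} \<longrightarrow> K F \<subseteq> L F)"
proof -
  have "ps_preimage (dyn_product_system \<alpha>) (gen i) (L F) = \<alpha> (gen i) -` L F"
    if "cstar_ideal (L F)" "i \<in> {1..d}" for i F
  proof -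
    have "gen i \<in> multi_indices d" using that(2) by (simp add: gen_def multi_indices_def)
    then have "star_endomorphism (\<alpha> (gen i))"
      using assms(2) by (simp add: cstar_dynamical_system_def)
    with that(1) show ?thesis by (rule ps_preimage_dyn_product_system)
  qed
  \<comment> \<open>The preimages agree only for ideals, but condition (i) occurs on both sides of
    the equivalence; where it fails, both sides are false.\<close>
  then have T: "(\<forall>F. F \<subset> {1..d} \<longrightarrow> (\<forall>i\<in>{1..d} - F.
        L F = ps_preimage (dyn_product_system \<alpha>) (gen i) (L F) \<inter> L (F \<union> {i}))) \<longleftrightarrow>
      (\<forall>F. F \<subset> {1..d} \<longrightarrow> (\<forall>i\<in>{1..d} - F. L F = \<alpha> (gen i) -` L F \<inter> L (F \<union> {i})))"
    if "\<forall>F. F \<subseteq> {1..d} \<longrightarrow> cstar_ideal (L F)"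
    using that by (simp add: psubset_imp_subset cong: imp_cong)
  show ?thesis
    unfolding relative_O_family_def T_family_def using assms(4)
    by (cases "\<forall>F. F \<subseteq> {1..d} \<longrightarrow> cstar_ideal (L F)") (simp_all only: T simp_thms conj_assoc)
qed

end
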